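(* Let $\mathbb{K}$ be a field of characteristic zero, $R$ a unital commutative associative $\mathbb{K}$-algebra, and let $\langle\cdot,\cdot\rangle\colon L\times N\to R$ be a duality pairing of two $R$-modules $L$ and $N$. Let $(D_0,X_0)\in\mathcal{CDO}(N)$, $y_0\in N$ and $E_0\in\mathrm{End}_{\mathbb{K}}(L)$ be such that the mapping $$L\times L\to R,\quad (\ell_1,\ell_2)\mapsto\langle\ell_1,y_0\rangle\,\langle\ell_2,D_0(y_0)\rangle$$ is symmetric and $$X_0(\langle\ell,n\rangle)=\langle E_0(\ell),n\rangle+\langle\ell,D_0(n)\rangle\quad\text{for all }\ell\in L,\ n\in N.$$ Define the anchor $\rho^L\colon L\to T_R$, $\rho^L(\ell):=\langle\ell,y_0\rangle X_0$, and $\nabla_{\ell_1}\ell_2:=\langle\ell_1,y_0\rangle E_0(\ell_2)$ for $\ell_1,\ell_2\in L$. Then $L$ is a $(\mathbb{K},R)$-Lie algebra (with anchor $\rho^L$) with respect to the bracket defined by $$[\ell_1,\ell_2]:=\nabla_{\ell_1}\ell_2-\nabla_{\ell_2}\ell_1\quad\text{for all }\ell_1,\ell_2\in L.$$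
   Context: $R$-modules are unital left modules. $T_R:=\mathrm{Der}(R)$ is the $R$-module and Lie algebra (under commutators) of all $\mathbb{K}$-linear derivations $R\to R$. A duality pairing of $R$-modules $L,N$ is an $R$-bilinear map $\langle\cdot,\cdot\rangle\colon L\times N\to R$ such that for $\ell\in L$: $\ell=0\iff\langle\ell,N\rangle=\{0\}$, and for $n\in N$: $n=0\iff\langle L,n\rangle=\{0\}$. For an $R$-module $N$, $$\mathcal{CDO}(N):=\{(D,X)\in\mathrm{End}_{\mathbb{K}}(N)\times\mathrm{Der}(R)\mid D(rn)=rD(n)+X(r)n\text{ for all }r\in R,\ n\in N\}.$$ A $(\mathbb{K},R)$-Lie algebra (Lie-Rinehart algebra) is a unital left $R$-module $L$ with an $R$-linear map $\rho\colon L\to T_R$ (the anchor) and a Lie algebra structure $[\cdot,\cdot]$ on $L$ over $\mathbb{K}$ such that $\rho$ is a Lie algebra homomorphism and $[\ell_1,r\cdot\ell_2]=r\cdot[\ell_1,\ell_2]+(\rho(\ell_1)r)\cdot\ell_2$ for all $r\in R$, $\ell_1,\ell_2\in L$. *)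

theory Defs
  imports "HOL-Algebra.Module"
begin

text \<open>
  Algebraic structures are HOL-Algebra records with explicit carriers, so the zero ring is
  admitted as base algebra. Elements of sets of maps are extensional functions
  (\<open>\<rightarrow>\<^sub>E\<close>, undefined off the carrier), so that equality of maps is equality in HOL.
\<close>

definition char_zero :: "('k, 'c) ring_scheme \<Rightarrow> bool" where
  "char_zero K \<longleftrightarrow> (\<forall>n::nat. n > 0 \<longrightarrow> [n] \<cdot>\<^bsub>K\<^esub> \<one>\<^bsub>K\<^esub> \<noteq> \<zero>\<^bsub>K\<^esub>)"

text \<open>The ring \<open>R\<close> as a module over itself, the codomain of the pairing.\<close>

definition self_module :: "('r, 'd) ring_scheme \<Rightarrow> ('r, 'r) module" where
  "self_module R = \<lparr>carrier = carrier R, mult = mult R, one = one R,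
     zero = zero R, add = add R, smult = mult R\<rparr>"

text \<open>
  A module over a \<open>K\<close>-algebra \<open>R\<close>, viewed as a \<open>K\<close>-vector space through the
  structure map \<open>k \<mapsto> k \<odot> 1\<close>.
\<close>

definition restrict_scalars ::
  "('k, 'r, 'd) module_scheme \<Rightarrow> ('r, 'm, 'e) module_scheme \<Rightarrow> ('k, 'm) module" where
  "restrict_scalars R M = \<lparr>carrier = carrier M, mult = mult M, one = one M,
     zero = zero M, add = add M, smult = (\<lambda>k x. (k \<odot>\<^bsub>R\<^esub> \<one>\<^bsub>R\<^esub>) \<odot>\<^bsub>M\<^esub> x)\<rparr>"

definition linear_maps ::
  "('a, 'c) ring_scheme \<Rightarrow> ('a, 'm, 'd) module_scheme \<Rightarrow> ('a, 'n, 'e) module_scheme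
    \<Rightarrow> ('m \<Rightarrow> 'n) set" where
  "linear_maps A M N = {f \<in> carrier M \<rightarrow>\<^sub>E carrier N.
     (\<forall>x\<in>carrier M. \<forall>y\<in>carrier M. f (x \<oplus>\<^bsub>M\<^esub> y) = f x \<oplus>\<^bsub>N\<^esub> f y) \<and>
     (\<forall>a\<in>carrier A. \<forall>x\<in>carrier M. f (a \<odot>\<^bsub>M\<^esub> x) = a \<odot>\<^bsub>N\<^esub> f x)}"

definition bilinear_map ::
  "('a, 'c) ring_scheme \<Rightarrow> ('a, 'm, 'd) module_scheme \<Rightarrow> ('a, 'n, 'e) module_scheme
    \<Rightarrow> ('a, 'p, 'f) module_scheme \<Rightarrow> ('m \<Rightarrow> 'n \<Rightarrow> 'p) \<Rightarrow> bool" where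
  "bilinear_map A M N P b \<longleftrightarrow>
     (\<forall>x\<in>carrier M. (\<lambda>y\<in>carrier N. b x y) \<in> linear_maps A N P) \<and>
     (\<forall>y\<in>carrier N. (\<lambda>x\<in>carrier M. b x y) \<in> linear_maps A M P)"

locale duality_pairing = L?: module R L + N?: module R N
  for R (structure) and L (structure) and N (structure)
    and p :: "'l \<Rightarrow> 'n \<Rightarrow> 'r" +
  assumes bilinear: "bilinear_map R L N (self_module R) p"
    and nondegenerate_left: "\<And>l. l \<in> carrier L \<Longrightarrow>
      l = \<zero>\<^bsub>L\<^esub> \<longleftrightarrow> p l ` carrier N = {\<zero>\<^bsub>R\<^esub>}"
    and nondegenerate_right: "\<And>n. n \<in> carrier N \<Longrightarrow>
      n = \<zero>\<^bsub>N\<^esub> \<longleftrightarrow> (\<lambda>l. p l n) ` carrier L = {\<zero>\<^bsub>R\<^esub>}"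

text \<open>\<open>K\<close>-linear endomorphisms of an \<open>R\<close>-module\<close>

definition End_K ::
  "('k, 'c) ring_scheme \<Rightarrow> ('k, 'r, 'd) module_scheme \<Rightarrow> ('r, 'm, 'e) module_scheme
    \<Rightarrow> ('m \<Rightarrow> 'm) set" where
  "End_K K R M = linear_maps K (restrict_scalars R M) (restrict_scalars R M)"

definition derivations ::
  "('k, 'c) ring_scheme \<Rightarrow> ('k, 'r, 'd) module_scheme \<Rightarrow> ('r \<Rightarrow> 'r) set" where
  "derivations K R = {X \<in> linear_maps K R R. \<forall>a\<in>carrier R. \<forall>b\<in>carrier R.
     X (a \<otimes>\<^bsub>R\<^esub> b) = X a \<otimes>\<^bsub>R\<^esub> b \<oplus>\<^bsub>R\<^esub> a \<otimes>\<^bsub>R\<^esub> X b}"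

text \<open>
  The \<open>R\<close>-module of derivations. The multiplicative fields \<open>mult\<close> and \<open>one\<close> of the
  module record are irrelevant for modules.
\<close>

definition der_module ::
  "('k, 'c) ring_scheme \<Rightarrow> ('k, 'r, 'd) module_scheme \<Rightarrow> ('r, 'r \<Rightarrow> 'r) module" where
  "der_module K R = \<lparr>carrier = derivations K R, mult = undefined, one = undefined,
     zero = (\<lambda>a\<in>carrier R. \<zero>\<^bsub>R\<^esub>),
     add = (\<lambda>X Y. \<lambda>a\<in>carrier R. X a \<oplus>\<^bsub>R\<^esub> Y a),
     smult = (\<lambda>r X. \<lambda>a\<in>carrier R. r \<otimes>\<^bsub>R\<^esub> X a)\<rparr>"

definition der_bracket ::
  "('r, 'd) ring_scheme \<Rightarrow> ('r \<Rightarrow> 'r) \<Rightarrow> ('r \<Rightarrow> 'r) \<Rightarrow> 'r \<Rightarrow> 'r" where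
  "der_bracket R X Y = (\<lambda>a\<in>carrier R. X (Y a) \<ominus>\<^bsub>R\<^esub> Y (X a))"

definition CDO ::
  "('k, 'c) ring_scheme \<Rightarrow> ('k, 'r, 'd) module_scheme \<Rightarrow> ('r, 'n, 'e) module_scheme
    \<Rightarrow> (('n \<Rightarrow> 'n) \<times> ('r \<Rightarrow> 'r)) set" where
  "CDO K R N = {(D, X) \<in> End_K K R N \<times> derivations K R.
     \<forall>r\<in>carrier R. \<forall>n\<in>carrier N.
       D (r \<odot>\<^bsub>N\<^esub> n) = r \<odot>\<^bsub>N\<^esub> D n \<oplus>\<^bsub>N\<^esub> X r \<odot>\<^bsub>N\<^esub> n}"

locale lie_algebra = field K + V?: module K V
  for K (structure) and V (structure) and br :: "'v \<Rightarrow> 'v \<Rightarrow> 'v" +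
  assumes bracket_bilinear: "bilinear_map K V V V br"
    and bracket_alternating: "\<And>x. x \<in> carrier V \<Longrightarrow> br x x = \<zero>\<^bsub>V\<^esub>"
    and jacobi: "\<And>x y z. \<lbrakk>x \<in> carrier V; y \<in> carrier V; z \<in> carrier V\<rbrakk> \<Longrightarrow>
      br x (br y z) \<oplus>\<^bsub>V\<^esub> br y (br z x) \<oplus>\<^bsub>V\<^esub> br z (br x y) = \<zero>\<^bsub>V\<^esub>"

definition lie_hom ::
  "('k, 'c) ring_scheme \<Rightarrow> ('k, 'v, 'd) module_scheme \<Rightarrow> ('v \<Rightarrow> 'v \<Rightarrow> 'v)
    \<Rightarrow> ('k, 'w, 'e) module_scheme \<Rightarrow> ('w \<Rightarrow> 'w \<Rightarrow> 'w) \<Rightarrow> ('v \<Rightarrow> 'w) set" where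
  "lie_hom K V br W br' = {f \<in> linear_maps K V W.
     \<forall>x\<in>carrier V. \<forall>y\<in>carrier V. f (br x y) = br' (f x) (f y)}"

locale lie_rinehart_algebra =
  A?: algebra K R + L?: module R L + lie_algebra K "restrict_scalars R L" br
  for K and R and L and \<rho> :: "'l \<Rightarrow> 'r \<Rightarrow> 'r" and br :: "'l \<Rightarrow> 'l \<Rightarrow> 'l" +
  assumes anchor_linear: "\<rho> \<in> linear_maps R L (der_module K R)"
    and anchor_lie_hom: "\<rho> \<in> lie_hom K (restrict_scalars R L) br
      (restrict_scalars R (der_module K R)) (der_bracket R)"
    and leibniz: "\<And>l1 l2 r. \<lbrakk>l1 \<in> carrier L; l2 \<in> carrier L; r \<in> carrier R\<rbrakk> \<Longrightarrow>
      br l1 (r \<odot>\<^bsub>L\<^esub> l2) = r \<odot>\<^bsub>L\<^esub> br l1 l2 \<oplus>\<^bsub>L\<^esub> (\<rho> l1 r) \<odot>\<^bsub>L\<^esub> l2"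

end

theory Submission
  imports Defs
begin

text \<open>
  Write \<open>a\<^sub>x = \<langle>x, y\<^sub>0\<rangle>\<close>, \<open>X = X\<^sub>0\<close>, \<open>D = D\<^sub>0\<close> and \<open>E = E\<^sub>0\<close>. The compatibility
  \<open>X\<langle>x, n\<rangle> = \<langle>E x, n\<rangle> + \<langle>x, D n\<rangle>\<close> says that \<open>-E\<close> is adjoint to \<open>D\<close> up to the
  derivation \<open>X\<close>. Since the pairing is nondegenerate, \<open>E\<close> inherits the rule
  \<open>E (r x) = r E x + (X r) x\<close> from the product rule for \<open>X\<close>, which yields the Leibniz rule of the bracket
  \<open>[x, y] = a\<^sub>x E y - a\<^sub>y E x\<close>.

  Everything else rests on one identity. Applying the compatibility to \<open>n = y\<^sub>0\<close>, the symmetry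
  hypothesis cancels the terms with \<open>D y\<^sub>0\<close> and leaves
  \[ \langle [x, y], y_0 \rangle = a_x X(a_y) - a_y X(a_x). \]
  This is precisely the coefficient of the commutator of the vector fields \<open>a\<^sub>x X\<close> and \<open>a\<^sub>y X\<close>,
  so the anchor is a homomorphism. Inserting it in \<open>[x, [y, z]]\<close> gives
  \[ [x, [y, z]] = a_x X(a_y) E z - a_x X(a_z) E y + a_x a_y E^2 z - a_x a_z E^2 y
      - a_y X(a_z) E x + a_z X(a_y) E x, \]
  and in the cyclic sum these terms cancel in pairs, those of second order because
  \<open>a\<^sub>x a\<^sub>y E\<^sup>2 z\<close> is symmetric in \<open>x\<close> and \<open>y\<close>. Linearity of the
  bracket over the base field is the Leibniz rule for scalars, on which derivations vanish.
\<close>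

section \<open>Modules over an algebra as vector spaces\<close>

lemma restrict_scalars_simps [simp]:
  "carrier (restrict_scalars R M) = carrier M"
  "add (restrict_scalars R M) = add M"
  "zero (restrict_scalars R M) = zero M"
  "smult (restrict_scalars R M) k x = (k \<odot>\<^bsub>R\<^esub> \<one>\<^bsub>R\<^esub>) \<odot>\<^bsub>M\<^esub> x"
  by (simp_all add: restrict_scalars_def)

lemma self_module_simps [simp]:
  "carrier (self_module R) = carrier R"
  "add (self_module R) = add R"
  "smult (self_module R) = mult R"
  by (simp_all add: self_module_def)

lemma der_module_simps [simp]:
  "carrier (der_module K R) = derivations K R"
  "add (der_module K R) X Y = (\<lambda>a\<in>carrier R. X a \<oplus>\<^bsub>R\<^esub> Y a)"
  "smult (der_module K R) r X = (\<lambda>a\<in>carrier R. r \<otimes>\<^bsub>R\<^esub> X a)"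
  by (simp_all add: der_module_def)

lemma (in algebra) scalar_one_mult:
  assumes "k \<in> carrier R" "x \<in> carrier M"
  shows "(k \<odot>\<^bsub>M\<^esub> \<one>\<^bsub>M\<^esub>) \<otimes>\<^bsub>M\<^esub> x = k \<odot>\<^bsub>M\<^esub> x"
  using assms by (simp add: smult_assoc2)

lemma module_restrict_scalars:
  assumes "algebra K R" and "module R M"
  shows "module K (restrict_scalars R M)"
proof -
  interpret A: algebra K R by fact
  interpret M: module R M by fact
  show ?thesis
  proof (rule moduleI)
    show "abelian_group (restrict_scalars R M)"
    proof (rule abelian_groupI)
      fix x assume "x \<in> carrier (restrict_scalars R M)"
      then show "\<exists>y\<in>carrier (restrict_scalars R M).
          y \<oplus>\<^bsub>restrict_scalars R M\<^esub> x = \<zero>\<^bsub>restrict_scalars R M\<^esub>"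
        by (auto intro!: bexI[of _ "\<ominus>\<^bsub>M\<^esub> x"] simp: M.M.l_neg)
    qed (simp_all add: M.M.a_ac)
    fix a b x assume *: "a \<in> carrier K" "b \<in> carrier K" "x \<in> carrier (restrict_scalars R M)"
    have "(a \<otimes>\<^bsub>K\<^esub> b) \<odot>\<^bsub>R\<^esub> \<one>\<^bsub>R\<^esub> = (a \<odot>\<^bsub>R\<^esub> \<one>\<^bsub>R\<^esub>) \<otimes>\<^bsub>R\<^esub> (b \<odot>\<^bsub>R\<^esub> \<one>\<^bsub>R\<^esub>)"
      using * by (simp add: A.scalar_one_mult A.smult_assoc1)
    then show "(a \<otimes>\<^bsub>K\<^esub> b) \<odot>\<^bsub>restrict_scalars R M\<^esub> x
        = a \<odot>\<^bsub>restrict_scalars R M\<^esub> (b \<odot>\<^bsub>restrict_scalars R M\<^esub> x)"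
      using * by (simp add: M.smult_assoc1)
  qed (simp_all add: A.R.is_cring M.smult_r_distr M.smult_l_distr A.smult_l_distr)
qed

lemma (in abelian_group) add_cancel_common:
  assumes "x \<in> carrier G" "y \<in> carrier G" "z \<in> carrier G"
  shows "(x \<oplus> z) \<oplus> \<ominus> (y \<oplus> z) = x \<oplus> \<ominus> y"
proof -
  have "(x \<oplus> z) \<oplus> \<ominus> (y \<oplus> z) = (x \<oplus> \<ominus> y) \<oplus> (z \<oplus> \<ominus> z)"
    using assms by (simp only: minus_add a_ac a_closed a_inv_closed)
  then show ?thesis
    using assms by (simp add: r_neg)
qed

lemma linear_maps_closed: "f \<in> linear_maps A M N \<Longrightarrow> x \<in> carrier M \<Longrightarrow> f x \<in> carrier N"
  by (auto simp: linear_maps_def)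

lemma linear_maps_add:
  "f \<in> linear_maps A M N \<Longrightarrow> x \<in> carrier M \<Longrightarrow> y \<in> carrier M
    \<Longrightarrow> f (x \<oplus>\<^bsub>M\<^esub> y) = f x \<oplus>\<^bsub>N\<^esub> f y"
  by (auto simp: linear_maps_def)

lemma linear_maps_smult:
  "f \<in> linear_maps A M N \<Longrightarrow> a \<in> carrier A \<Longrightarrow> x \<in> carrier M
    \<Longrightarrow> f (a \<odot>\<^bsub>M\<^esub> x) = a \<odot>\<^bsub>N\<^esub> f x"
  by (auto simp: linear_maps_def)

lemma additive_uminus:
  assumes "abelian_group G" "abelian_group H"
    and closed: "\<And>x. x \<in> carrier G \<Longrightarrow> f x \<in> carrier H"
    and add: "\<And>x y. x \<in> carrier G \<Longrightarrow> y \<in> carrier G \<Longrightarrow> f (x \<oplus>\<^bsub>G\<^esub> y) = f x \<oplus>\<^bsub>H\<^esub> f y"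
    and x: "x \<in> carrier G"
  shows "f (\<ominus>\<^bsub>G\<^esub> x) = \<ominus>\<^bsub>H\<^esub> f x"
proof -
  interpret G: abelian_group G by fact
  interpret H: abelian_group H by fact
  have "f \<zero>\<^bsub>G\<^esub> \<oplus>\<^bsub>H\<^esub> f \<zero>\<^bsub>G\<^esub> = f \<zero>\<^bsub>G\<^esub>"
    using add[of "\<zero>\<^bsub>G\<^esub>" "\<zero>\<^bsub>G\<^esub>"] by simp
  then have "f \<zero>\<^bsub>G\<^esub> = \<zero>\<^bsub>H\<^esub>"
    using closed[of "\<zero>\<^bsub>G\<^esub>"] by simp
  then have "f (\<ominus>\<^bsub>G\<^esub> x) \<oplus>\<^bsub>H\<^esub> f x = \<zero>\<^bsub>H\<^esub>"
    using add[of "\<ominus>\<^bsub>G\<^esub> x" x] x by (simp add: G.l_neg)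
  then show ?thesis
    using x closed by (metis H.minus_equality G.a_inv_closed)
qed

section \<open>Derivations\<close>

text \<open>
  A derivation kills \<open>\<one>\<close>, since \<open>X 1 = X 1 + X 1\<close>, and hence all multiples of \<open>\<one>\<close> by
  elements of the base field.
\<close>

lemma derivation_scalar:
  assumes "algebra K R" and X: "X \<in> derivations K R" and k: "k \<in> carrier K"
  shows "X (k \<odot>\<^bsub>R\<^esub> \<one>\<^bsub>R\<^esub>) = \<zero>\<^bsub>R\<^esub>"
proof -
  interpret A: algebra K R by fact
  have lin: "X \<in> linear_maps K R R"
    using X by (simp add: derivations_def)
  have X1: "X \<one>\<^bsub>R\<^esub> \<in> carrier R"
    using linear_maps_closed[OF lin] by simp
  have "X (\<one>\<^bsub>R\<^esub> \<otimes>\<^bsub>R\<^esub> \<one>\<^bsub>R\<^esub>) = X \<one>\<^bsub>R\<^esub> \<otimes>\<^bsub>R\<^esub> \<one>\<^bsub>R\<^esub> \<oplus>\<^bsub>R\<^esub> \<one>\<^bsub>R\<^esub> \<otimes>\<^bsub>R\<^esub> X \<one>\<^bsub>R\<^esub>"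
    using X unfolding derivations_def by blast
  then have "X \<one>\<^bsub>R\<^esub> = \<zero>\<^bsub>R\<^esub>"
    using X1 by simp
  then show ?thesis
    using linear_maps_smult[OF lin k] k by simp
qed

lemma smult_derivation:
  assumes "algebra K R" and X: "X \<in> derivations K R" and r: "r \<in> carrier R"
  shows "(\<lambda>a\<in>carrier R. r \<otimes>\<^bsub>R\<^esub> X a) \<in> derivations K R"
proof -
  interpret A: algebra K R by fact
  have lin: "X \<in> linear_maps K R R"
    using X by (simp add: derivations_def)
  note closed = linear_maps_closed[OF lin]
  have leibniz: "X (a \<otimes>\<^bsub>R\<^esub> b) = X a \<otimes>\<^bsub>R\<^esub> b \<oplus>\<^bsub>R\<^esub> a \<otimes>\<^bsub>R\<^esub> X b"
    if "a \<in> carrier R" "b \<in> carrier R" for a b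
    using X that by (simp add: derivations_def)
  have scalar: "r \<otimes>\<^bsub>R\<^esub> X (k \<odot>\<^bsub>R\<^esub> a) = k \<odot>\<^bsub>R\<^esub> (r \<otimes>\<^bsub>R\<^esub> X a)"
    if "k \<in> carrier K" "a \<in> carrier R" for k a
    using that r closed
    by (simp add: linear_maps_smult[OF lin] A.smult_assoc2 A.m_comm[of r])
  show ?thesis
    using r closed
    by (simp add: derivations_def linear_maps_def linear_maps_add[OF lin] scalar leibniz
        A.r_distr A.m_assoc A.m_lcomm)
qed

section \<open>The dual of a covariant differential operator\<close>

locale dual_operators =
  A: algebra K R + P: duality_pairing R L N p
  for K :: "('k, 'c) ring_scheme"
    and R :: "('k, 'r, 'd) module_scheme" (structure)
    and L :: "('r, 'l, 'e) module_scheme" (structure)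
    and N :: "('r, 'n, 'f) module_scheme" (structure)
    and p :: "'l \<Rightarrow> 'n \<Rightarrow> 'r" +
  fixes D :: "'n \<Rightarrow> 'n" and X :: "'r \<Rightarrow> 'r" and E :: "'l \<Rightarrow> 'l"
  assumes D_CDO: "(D, X) \<in> CDO K R N"
    and E_End: "E \<in> End_K K R L"
    and compatible: "\<And>l n. l \<in> carrier L \<Longrightarrow> n \<in> carrier N
      \<Longrightarrow> X (p l n) = p (E l) n \<oplus>\<^bsub>R\<^esub> p l (D n)"
begin

lemma X_derivation: "X \<in> derivations K R"
  using D_CDO by (simp add: CDO_def)

lemma X_linear: "X \<in> linear_maps K R R"
  using X_derivation by (simp add: derivations_def)

lemma X_closed [simp]: "r \<in> carrier R \<Longrightarrow> X r \<in> carrier R"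
  by (rule linear_maps_closed[OF X_linear])

lemma X_mult:
  "r \<in> carrier R \<Longrightarrow> s \<in> carrier R \<Longrightarrow> X (r \<otimes>\<^bsub>R\<^esub> s) = X r \<otimes>\<^bsub>R\<^esub> s \<oplus>\<^bsub>R\<^esub> r \<otimes>\<^bsub>R\<^esub> X s"
  using X_derivation by (simp add: derivations_def)

lemma D_closed [simp]: "n \<in> carrier N \<Longrightarrow> D n \<in> carrier N"
  using D_CDO by (auto simp: CDO_def End_K_def dest: linear_maps_closed)

lemma E_closed [simp]: "l \<in> carrier L \<Longrightarrow> E l \<in> carrier L"
  using E_End by (auto simp: End_K_def dest: linear_maps_closed)

lemma E_add:
  "l \<in> carrier L \<Longrightarrow> m \<in> carrier L \<Longrightarrow> E (l \<oplus>\<^bsub>L\<^esub> m) = E l \<oplus>\<^bsub>L\<^esub> E m"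
  using E_End by (auto simp: End_K_def dest: linear_maps_add)

lemma E_uminus: "l \<in> carrier L \<Longrightarrow> E (\<ominus>\<^bsub>L\<^esub> l) = \<ominus>\<^bsub>L\<^esub> E l"
  by (rule additive_uminus) (simp_all add: P.L.M.abelian_group_axioms E_add)

lemma
  assumes "n \<in> carrier N"
  shows p_closed [simp]: "l \<in> carrier L \<Longrightarrow> p l n \<in> carrier R"
    and p_add: "l \<in> carrier L \<Longrightarrow> m \<in> carrier L \<Longrightarrow> p (l \<oplus>\<^bsub>L\<^esub> m) n = p l n \<oplus>\<^bsub>R\<^esub> p m n"
    and p_smult: "r \<in> carrier R \<Longrightarrow> l \<in> carrier L \<Longrightarrow> p (r \<odot>\<^bsub>L\<^esub> l) n = r \<otimes>\<^bsub>R\<^esub> p l n"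
proof -
  have lin: "(\<lambda>l\<in>carrier L. p l n) \<in> linear_maps R L (self_module R)"
    using P.bilinear assms by (simp add: bilinear_map_def)
  show "l \<in> carrier L \<Longrightarrow> p l n \<in> carrier R"
    using linear_maps_closed[OF lin] by simp
  show "l \<in> carrier L \<Longrightarrow> m \<in> carrier L \<Longrightarrow> p (l \<oplus>\<^bsub>L\<^esub> m) n = p l n \<oplus>\<^bsub>R\<^esub> p m n"
    using linear_maps_add[OF lin, of l m] by simp
  show "r \<in> carrier R \<Longrightarrow> l \<in> carrier L \<Longrightarrow> p (r \<odot>\<^bsub>L\<^esub> l) n = r \<otimes>\<^bsub>R\<^esub> p l n"
    using linear_maps_smult[OF lin, of r l] by simp
qed

lemma p_uminus:
  "l \<in> carrier L \<Longrightarrow> n \<in> carrier N \<Longrightarrow> p (\<ominus>\<^bsub>L\<^esub> l) n = \<ominus>\<^bsub>R\<^esub> p l n"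
  by (rule additive_uminus[where f = "\<lambda>l. p l n"])
    (simp_all add: P.L.M.abelian_group_axioms A.M.abelian_group_axioms p_add)

lemma pairing_separates:
  assumes l: "l \<in> carrier L" and m: "m \<in> carrier L"
    and eq: "\<And>n. n \<in> carrier N \<Longrightarrow> p l n = p m n"
  shows "l = m"
proof -
  have "p (l \<oplus>\<^bsub>L\<^esub> \<ominus>\<^bsub>L\<^esub> m) n = \<zero>\<^bsub>R\<^esub>" if "n \<in> carrier N" for n
    using that l m eq[OF that] by (simp add: p_add p_uminus A.M.r_neg)
  then have "p (l \<oplus>\<^bsub>L\<^esub> \<ominus>\<^bsub>L\<^esub> m) ` carrier N = {\<zero>\<^bsub>R\<^esub>}"
    using P.N.M.zero_closed by force
  then have "l \<oplus>\<^bsub>L\<^esub> \<ominus>\<^bsub>L\<^esub> m = \<zero>\<^bsub>L\<^esub>"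
    using P.nondegenerate_left[of "l \<oplus>\<^bsub>L\<^esub> \<ominus>\<^bsub>L\<^esub> m"] l m by simp
  then show ?thesis
    using l m by (metis P.L.M.a_inv_closed P.L.M.minus_equality P.L.M.minus_minus)
qed

text \<open>
  Both sides have the same pairing with every \<open>n\<close>: differentiating \<open>\<langle>r l, n\<rangle> = r \<langle>l, n\<rangle>\<close> with the
  compatibility on the left and the product rule on the right, the terms \<open>r \<langle>l, D n\<rangle>\<close> cancel.
\<close>

lemma E_smult:
  assumes r: "r \<in> carrier R" and l: "l \<in> carrier L"
  shows "E (r \<odot>\<^bsub>L\<^esub> l) = r \<odot>\<^bsub>L\<^esub> E l \<oplus>\<^bsub>L\<^esub> X r \<odot>\<^bsub>L\<^esub> l"
proof (rule pairing_separates)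
  fix n assume n: "n \<in> carrier N"
  have "p (E (r \<odot>\<^bsub>L\<^esub> l)) n \<oplus>\<^bsub>R\<^esub> r \<otimes>\<^bsub>R\<^esub> p l (D n) = X (p (r \<odot>\<^bsub>L\<^esub> l) n)"
    using r l n by (simp add: compatible p_smult[of "D n", symmetric])
  also have "\<dots> = X r \<otimes>\<^bsub>R\<^esub> p l n \<oplus>\<^bsub>R\<^esub> r \<otimes>\<^bsub>R\<^esub> (p (E l) n \<oplus>\<^bsub>R\<^esub> p l (D n))"
    using r l n by (simp add: X_mult p_smult compatible)
  also have "\<dots> = p (r \<odot>\<^bsub>L\<^esub> E l \<oplus>\<^bsub>L\<^esub> X r \<odot>\<^bsub>L\<^esub> l) n \<oplus>\<^bsub>R\<^esub> r \<otimes>\<^bsub>R\<^esub> p l (D n)"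
    using r l n by (simp add: p_add p_smult A.r_distr A.M.a_ac)
  finally show "p (E (r \<odot>\<^bsub>L\<^esub> l)) n = p (r \<odot>\<^bsub>L\<^esub> E l \<oplus>\<^bsub>L\<^esub> X r \<odot>\<^bsub>L\<^esub> l) n"
    using r l n by simp
qed (use r l in simp_all)

end

section \<open>The Lie-Rinehart structure\<close>

locale dual_operators_bracket = dual_operators K R L N p D X E
  for K :: "('k, 'c) ring_scheme"
    and R :: "('k, 'r, 'd) module_scheme" (structure)
    and L :: "('r, 'l, 'e) module_scheme" (structure)
    and N :: "('r, 'n, 'f) module_scheme" (structure)
    and p :: "'l \<Rightarrow> 'n \<Rightarrow> 'r"
    and D :: "'n \<Rightarrow> 'n" and X :: "'r \<Rightarrow> 'r" and E :: "'l \<Rightarrow> 'l" +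
  fixes y0 :: 'n and br :: "'l \<Rightarrow> 'l \<Rightarrow> 'l"
  assumes y0 [simp]: "y0 \<in> carrier N"
    and symmetric: "\<And>x y. x \<in> carrier L \<Longrightarrow> y \<in> carrier L
      \<Longrightarrow> p x y0 \<otimes>\<^bsub>R\<^esub> p y (D y0) = p y y0 \<otimes>\<^bsub>R\<^esub> p x (D y0)"
    and br_eq: "\<And>x y. x \<in> carrier L \<Longrightarrow> y \<in> carrier L
      \<Longrightarrow> br x y = p x y0 \<odot>\<^bsub>L\<^esub> E y \<oplus>\<^bsub>L\<^esub> \<ominus>\<^bsub>L\<^esub> (p y y0 \<odot>\<^bsub>L\<^esub> E x)"
begin

lemma br_closed [simp]: "x \<in> carrier L \<Longrightarrow> y \<in> carrier L \<Longrightarrow> br x y \<in> carrier L"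
  by (simp add: br_eq)

lemma br_self: "x \<in> carrier L \<Longrightarrow> br x x = \<zero>\<^bsub>L\<^esub>"
  by (simp add: br_eq P.L.M.r_neg)

lemma br_antisym: "x \<in> carrier L \<Longrightarrow> y \<in> carrier L \<Longrightarrow> br y x = \<ominus>\<^bsub>L\<^esub> br x y"
  by (simp add: br_eq P.L.M.minus_add P.L.M.a_comm)

lemma br_add_right:
  "x \<in> carrier L \<Longrightarrow> y \<in> carrier L \<Longrightarrow> z \<in> carrier L
    \<Longrightarrow> br x (y \<oplus>\<^bsub>L\<^esub> z) = br x y \<oplus>\<^bsub>L\<^esub> br x z"
  by (simp add: br_eq E_add p_add P.L.smult_r_distr P.L.smult_l_distr P.L.M.minus_add P.L.M.a_ac)

lemma br_leibniz:
  assumes "x \<in> carrier L" "y \<in> carrier L" "r \<in> carrier R"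
  shows "br x (r \<odot>\<^bsub>L\<^esub> y) = r \<odot>\<^bsub>L\<^esub> br x y \<oplus>\<^bsub>L\<^esub> (p x y0 \<otimes>\<^bsub>R\<^esub> X r) \<odot>\<^bsub>L\<^esub> y"
  using assms
  by (simp add: br_eq E_smult p_smult P.L.smult_r_distr P.L.smult_r_minus P.L.M.a_ac
      P.L.smult_assoc1[symmetric] A.m_comm[of r])

lemma br_scalar_right:
  assumes "x \<in> carrier L" "y \<in> carrier L" "k \<in> carrier K"
  shows "br x ((k \<odot>\<^bsub>R\<^esub> \<one>\<^bsub>R\<^esub>) \<odot>\<^bsub>L\<^esub> y) = (k \<odot>\<^bsub>R\<^esub> \<one>\<^bsub>R\<^esub>) \<odot>\<^bsub>L\<^esub> br x y"
  using assms
  by (simp add: br_leibniz derivation_scalar[OF A.algebra_axioms X_derivation])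

lemma br_bilinear:
  "bilinear_map K (restrict_scalars R L) (restrict_scalars R L) (restrict_scalars R L) br"
proof -
  have add_left: "br (x \<oplus>\<^bsub>L\<^esub> y) z = br x z \<oplus>\<^bsub>L\<^esub> br y z"
    if "x \<in> carrier L" "y \<in> carrier L" "z \<in> carrier L" for x y z
    using that by (simp add: br_antisym[of z] br_add_right P.L.M.minus_add)
  have scalar_left: "br ((k \<odot>\<^bsub>R\<^esub> \<one>\<^bsub>R\<^esub>) \<odot>\<^bsub>L\<^esub> x) z = (k \<odot>\<^bsub>R\<^esub> \<one>\<^bsub>R\<^esub>) \<odot>\<^bsub>L\<^esub> br x z"
    if "x \<in> carrier L" "z \<in> carrier L" "k \<in> carrier K" for x z k
    using that by (simp add: br_antisym[of z] br_scalar_right P.L.smult_r_minus)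
  show ?thesis
    by (simp add: bilinear_map_def linear_maps_def add_left scalar_left br_add_right
        br_scalar_right)
qed

text \<open>
  The compatibility turns \<open>\<langle>E y, y\<^sub>0\<rangle>\<close> into \<open>X \<langle>y, y\<^sub>0\<rangle> - \<langle>y, D y\<^sub>0\<rangle>\<close>; the two resulting terms with
  \<open>D y\<^sub>0\<close> cancel by symmetry.
\<close>

lemma pairing_br:
  assumes x: "x \<in> carrier L" and y: "y \<in> carrier L"
  shows "p (br x y) y0 = p x y0 \<otimes>\<^bsub>R\<^esub> X (p y y0) \<oplus>\<^bsub>R\<^esub> \<ominus>\<^bsub>R\<^esub> (p y y0 \<otimes>\<^bsub>R\<^esub> X (p x y0))"
proof -
  have "p x y0 \<otimes>\<^bsub>R\<^esub> X (p y y0) \<oplus>\<^bsub>R\<^esub> \<ominus>\<^bsub>R\<^esub> (p y y0 \<otimes>\<^bsub>R\<^esub> X (p x y0))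
    = (p x y0 \<otimes>\<^bsub>R\<^esub> p (E y) y0 \<oplus>\<^bsub>R\<^esub> p x y0 \<otimes>\<^bsub>R\<^esub> p y (D y0))
      \<oplus>\<^bsub>R\<^esub> \<ominus>\<^bsub>R\<^esub> (p y y0 \<otimes>\<^bsub>R\<^esub> p (E x) y0 \<oplus>\<^bsub>R\<^esub> p x y0 \<otimes>\<^bsub>R\<^esub> p y (D y0))"
    using x y by (simp add: compatible A.r_distr symmetric[of x y])
  also have "\<dots> = p x y0 \<otimes>\<^bsub>R\<^esub> p (E y) y0 \<oplus>\<^bsub>R\<^esub> \<ominus>\<^bsub>R\<^esub> (p y y0 \<otimes>\<^bsub>R\<^esub> p (E x) y0)"
    using x y by (simp add: A.M.add_cancel_common)
  also have "\<dots> = p (br x y) y0"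
    using x y by (simp add: br_eq p_add p_uminus p_smult)
  finally show ?thesis ..
qed

text \<open>
  The terms \<open>T\<close> and \<open>S\<close> are of first and second order in \<open>E\<close>. Separating the terms of the double
  bracket by sign into \<open>P u v w\<close> and \<open>P u w v\<close>, the Jacobi identity says that \<open>P\<close> has the same sum
  over the even as over the odd permutations of \<open>x, y, z\<close>. For \<open>S\<close> this holds because
  \<open>S u v w = S v u w\<close>, and for \<open>T\<close> because each of its six values occurs once in either sum.
\<close>

lemma br_jacobi:
  assumes xyz: "x \<in> carrier L" "y \<in> carrier L" "z \<in> carrier L"
  shows "br x (br y z) \<oplus>\<^bsub>L\<^esub> br y (br z x) \<oplus>\<^bsub>L\<^esub> br z (br x y) = \<zero>\<^bsub>L\<^esub>"
proof -
  define T where "T u v w = (p u y0 \<otimes>\<^bsub>R\<^esub> X (p v y0)) \<odot>\<^bsub>L\<^esub> E w" for u v w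
  define S where "S u v w = (p u y0 \<otimes>\<^bsub>R\<^esub> p v y0) \<odot>\<^bsub>L\<^esub> E (E w)" for u v w
  define P where "P u v w = S u v w \<oplus>\<^bsub>L\<^esub> T u v w \<oplus>\<^bsub>L\<^esub> T w v u" for u v w
  have T_closed: "T u v w \<in> carrier L" and S_closed: "S u v w \<in> carrier L"
    and P_closed: "P u v w \<in> carrier L"
    if "u \<in> carrier L" "v \<in> carrier L" "w \<in> carrier L" for u v w
    using that by (simp_all add: T_def S_def P_def)
  have S_sym: "S u v w = S v u w" if "u \<in> carrier L" "v \<in> carrier L" for u v w
    using that by (simp add: S_def A.m_comm)
  have double: "br u (br v w) = P u v w \<oplus>\<^bsub>L\<^esub> \<ominus>\<^bsub>L\<^esub> P u w v"
    if uvw: "u \<in> carrier L" "v \<in> carrier L" "w \<in> carrier L" for u v w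
  proof -
    have "p u y0 \<odot>\<^bsub>L\<^esub> E (br v w) = S u v w \<oplus>\<^bsub>L\<^esub> T u v w \<oplus>\<^bsub>L\<^esub> \<ominus>\<^bsub>L\<^esub> (S u w v \<oplus>\<^bsub>L\<^esub> T u w v)"
      using uvw
      by (simp add: br_eq[of v w] E_add E_uminus E_smult S_def T_def P.L.smult_r_distr
          P.L.smult_r_minus P.L.smult_assoc1)
    moreover have "p (br v w) y0 \<odot>\<^bsub>L\<^esub> E u = T v w u \<oplus>\<^bsub>L\<^esub> \<ominus>\<^bsub>L\<^esub> T w v u"
      using uvw by (simp add: pairing_br T_def P.L.smult_l_distr P.L.smult_l_minus)
    ultimately show ?thesis
      using uvw
      by (simp add: br_eq[of u "br v w"] P_def T_closed S_closed P.L.M.minus_add P.L.M.a_ac)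
  qed
  have "P x y z \<oplus>\<^bsub>L\<^esub> P y z x \<oplus>\<^bsub>L\<^esub> P z x y = P x z y \<oplus>\<^bsub>L\<^esub> P y x z \<oplus>\<^bsub>L\<^esub> P z y x"
    using xyz
    by (simp add: P_def S_sym[of y x] S_sym[of z x] S_sym[of z y] T_closed S_closed P.L.M.a_ac)
  moreover have "br x (br y z) \<oplus>\<^bsub>L\<^esub> br y (br z x) \<oplus>\<^bsub>L\<^esub> br z (br x y)
      = (P x y z \<oplus>\<^bsub>L\<^esub> P y z x \<oplus>\<^bsub>L\<^esub> P z x y) \<oplus>\<^bsub>L\<^esub> \<ominus>\<^bsub>L\<^esub> (P x z y \<oplus>\<^bsub>L\<^esub> P y x z \<oplus>\<^bsub>L\<^esub> P z y x)"
    using xyz by (simp add: double P_closed P.L.M.minus_add P.L.M.a_ac)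
  ultimately show ?thesis
    using xyz by (simp add: P_closed P.L.M.r_neg)
qed

lemma lie_algebra_br:
  assumes "field K"
  shows "lie_algebra K (restrict_scalars R L) br"
  using assms module_restrict_scalars[OF A.algebra_axioms P.L.module_axioms]
  by (simp add: lie_algebra_def lie_algebra_axioms_def br_bilinear br_self br_jacobi)

definition anchor :: "'l \<Rightarrow> 'r \<Rightarrow> 'r" where
  "anchor = (\<lambda>l\<in>carrier L. p l y0 \<odot>\<^bsub>der_module K R\<^esub> X)"

lemma anchor_apply: "l \<in> carrier L \<Longrightarrow> r \<in> carrier R \<Longrightarrow> anchor l r = p l y0 \<otimes>\<^bsub>R\<^esub> X r"
  by (simp add: anchor_def)

lemma anchor_derivation: "l \<in> carrier L \<Longrightarrow> anchor l \<in> derivations K R"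
  by (simp add: anchor_def smult_derivation[OF A.algebra_axioms X_derivation])

lemma anchor_linear: "anchor \<in> linear_maps R L (der_module K R)"
proof -
  have "anchor \<in> carrier L \<rightarrow>\<^sub>E derivations K R"
    using anchor_derivation by (auto simp: anchor_def)
  moreover have "anchor (x \<oplus>\<^bsub>L\<^esub> y) = anchor x \<oplus>\<^bsub>der_module K R\<^esub> anchor y"
    if "x \<in> carrier L" "y \<in> carrier L" for x y
    using that by (auto simp: anchor_def p_add A.l_distr fun_eq_iff)
  moreover have "anchor (r \<odot>\<^bsub>L\<^esub> x) = r \<odot>\<^bsub>der_module K R\<^esub> anchor x"
    if "r \<in> carrier R" "x \<in> carrier L" for r x
    using that by (auto simp: anchor_def p_smult A.m_assoc fun_eq_iff)
  ultimately show ?thesis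
    unfolding linear_maps_def by simp
qed

text \<open>
  In \<open>[a X, b X] = (a X(b) - b X(a)) X\<close> the second-order terms \<open>a b X\<^sup>2\<close> cancel, and the remaining
  coefficient is the pairing of the bracket with \<open>y\<^sub>0\<close>.
\<close>

lemma anchor_br:
  assumes x: "x \<in> carrier L" and y: "y \<in> carrier L"
  shows "anchor (br x y) = der_bracket R (anchor x) (anchor y)"
proof
  fix r
  show "anchor (br x y) r = der_bracket R (anchor x) (anchor y) r"
  proof (cases "r \<in> carrier R")
    case True
    define a b where "a = p x y0" and "b = p y y0"
    have ab: "a \<in> carrier R" "b \<in> carrier R"
      using x y by (simp_all add: a_def b_def)
    have "der_bracket R (anchor x) (anchor y) r
        = a \<otimes>\<^bsub>R\<^esub> X (b \<otimes>\<^bsub>R\<^esub> X r) \<ominus>\<^bsub>R\<^esub> b \<otimes>\<^bsub>R\<^esub> X (a \<otimes>\<^bsub>R\<^esub> X r)"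
      using True x y ab by (simp add: der_bracket_def anchor_apply a_def b_def)
    also have "\<dots> = (a \<otimes>\<^bsub>R\<^esub> (X b \<otimes>\<^bsub>R\<^esub> X r) \<oplus>\<^bsub>R\<^esub> a \<otimes>\<^bsub>R\<^esub> (b \<otimes>\<^bsub>R\<^esub> X (X r)))
        \<oplus>\<^bsub>R\<^esub> \<ominus>\<^bsub>R\<^esub> (b \<otimes>\<^bsub>R\<^esub> (X a \<otimes>\<^bsub>R\<^esub> X r) \<oplus>\<^bsub>R\<^esub> a \<otimes>\<^bsub>R\<^esub> (b \<otimes>\<^bsub>R\<^esub> X (X r)))"
      using True ab by (simp add: X_mult A.r_distr A.M.minus_eq A.m_lcomm[of b a])
    also have "\<dots> = a \<otimes>\<^bsub>R\<^esub> (X b \<otimes>\<^bsub>R\<^esub> X r) \<oplus>\<^bsub>R\<^esub> \<ominus>\<^bsub>R\<^esub> (b \<otimes>\<^bsub>R\<^esub> (X a \<otimes>\<^bsub>R\<^esub> X r))"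
      using True ab by (simp add: A.M.add_cancel_common)
    also have "\<dots> = (a \<otimes>\<^bsub>R\<^esub> X b \<oplus>\<^bsub>R\<^esub> \<ominus>\<^bsub>R\<^esub> (b \<otimes>\<^bsub>R\<^esub> X a)) \<otimes>\<^bsub>R\<^esub> X r"
      using True ab by (simp add: A.l_distr A.l_minus A.m_assoc)
    also have "\<dots> = anchor (br x y) r"
      using True x y by (simp add: anchor_apply pairing_br a_def b_def)
    finally show ?thesis ..
  next
    case False
    then show ?thesis
      using x y by (simp add: anchor_def der_bracket_def)
  qed
qed

lemma anchor_lie_hom:
  "anchor \<in> lie_hom K (restrict_scalars R L) br
    (restrict_scalars R (der_module K R)) (der_bracket R)"
proof -
  have "anchor \<in> linear_maps K (restrict_scalars R L) (restrict_scalars R (der_module K R))"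
    using anchor_linear by (auto simp: linear_maps_def)
  then show ?thesis
    by (simp add: lie_hom_def anchor_br)
qed

lemma lie_rinehart_algebra_br:
  assumes "field K"
  shows "lie_rinehart_algebra K R L anchor br"
  using lie_algebra_br[OF assms] A.algebra_axioms P.L.module_axioms
  by (simp add: lie_rinehart_algebra_def lie_rinehart_algebra_axioms_def anchor_linear
      anchor_lie_hom br_leibniz anchor_apply)

end

theorem corollary4p9:
  fixes K :: "('k, 'c) ring_scheme"
    and R :: "('k, 'r, 'd) module_scheme"
    and L :: "('r, 'l, 'e) module_scheme"
    and N :: "('r, 'n, 'f) module_scheme"
    and p :: "'l \<Rightarrow> 'n \<Rightarrow> 'r"
    and D0 :: "'n \<Rightarrow> 'n" and X0 :: "'r \<Rightarrow> 'r" and y0 :: 'n and E0 :: "'l \<Rightarrow> 'l"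
    and \<rho> :: "'l \<Rightarrow> 'r \<Rightarrow> 'r" and nabla :: "'l \<Rightarrow> 'l \<Rightarrow> 'l" and br :: "'l \<Rightarrow> 'l \<Rightarrow> 'l"
  assumes "field K" and "char_zero K"
    and "algebra K R"
    and "duality_pairing R L N p"
    and "(D0, X0) \<in> CDO K R N"
    and "y0 \<in> carrier N"
    and "E0 \<in> End_K K R L"
    and "\<forall>l1\<in>carrier L. \<forall>l2\<in>carrier L.
      p l1 y0 \<otimes>\<^bsub>R\<^esub> p l2 (D0 y0) = p l2 y0 \<otimes>\<^bsub>R\<^esub> p l1 (D0 y0)"
    and "\<forall>l\<in>carrier L. \<forall>n\<in>carrier N. X0 (p l n) = p (E0 l) n \<oplus>\<^bsub>R\<^esub> p l (D0 n)"
    and "\<rho> = (\<lambda>l\<in>carrier L. p l y0 \<odot>\<^bsub>der_module K R\<^esub> X0)"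
    and "\<forall>l1\<in>carrier L. \<forall>l2\<in>carrier L. nabla l1 l2 = p l1 y0 \<odot>\<^bsub>L\<^esub> E0 l2"
    and "\<forall>l1\<in>carrier L. \<forall>l2\<in>carrier L. br l1 l2 = nabla l1 l2 \<ominus>\<^bsub>L\<^esub> nabla l2 l1"
  shows "lie_rinehart_algebra K R L \<rho> br"
proof -
  interpret dual_operators_bracket K R L N p D0 X0 E0 y0 br
    unfolding dual_operators_bracket_def dual_operators_def dual_operators_axioms_def
      dual_operators_bracket_axioms_def
    using assms by (simp add: a_minus_def)
  have "\<rho> = anchor"
    using assms by (simp add: anchor_def)
  then show ?thesis
    using lie_rinehart_algebra_br[OF \<open>field K\<close>] by simp
qed

end
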